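(* Consider the family of directrices $d_K(\cdot,\cdot,\alpha)=0$, with parameter $\alpha$, of the Kepler flight ellipses with semi-major axis $a$, one focus at the origin $F=(0,0)$ and second focus on the foci circle of radius $R$ centered at $F'=(2\mathbf{c}_K,0)$. (i) If $2\mathbf{c}_K\neq R$, then the envelope of the family of directrices is contained in either an ellipse or a hyperbola. The equation for these two kinds of conic sections is $$\frac{4(R^2-4\mathbf{c}_K^2)^2\left(x+\mathbf{c}_K\cdot\frac{4\mathbf{c}_K^2-R^2-4a^2}{R^2-4\mathbf{c}_K^2}\right)^2}{R^2(4a^2+4\mathbf{c}_K^2-R^2)^2}+\frac{4(R^2-4\mathbf{c}_K^2)\,y^2}{(4a^2+4\mathbf{c}_K^2-R^2)^2}=1.$$ (ii) If $2\mathbf{c}_K=R$, i.e. when the foci circle passes through $F$, the envelope curve for the family of directrices is the parabolic arc with equation $$x=\frac{\mathbf{c}_K}{2a^2}\,y^2-\frac{a^2}{2\mathbf{c}_K}+2\mathbf{c}_K.$$ In all cases one focus of these conic sections lies at $F'=(2\mathbf{c}_K,0)$, i.e. at the second focus of the boundary conic $\mathcal{B}_K$. In the case $2\mathbf{c}_K\neq R$ the second focus lies at $\left(-\frac{8a^2\mathbf{c}_K}{4\mathbf{c}_K^2-R^2},0\right)$.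
   Context: Setting: in the Kepler billiard with boundary a conic section $\mathcal{B}_K$ with foci $F=(0,0)$ (the Kepler center) and $F'=(2\mathbf{c}_K,0)$, where $\mathbf{c}_K$ is the linear eccentricity of $\mathcal{B}_K$, all flight ellipses (the Kepler ellipses containing the successive orbit arcs between reflections) along a billiard orbit have the same semi-major axis $a$, one focus at $F$, and second focus on a fixed circle (the foci circle) of radius $R$ centered at $F'$. Write the second focus as $(F_x,F_y)=(2\mathbf{c}_K+R\cos\alpha,\,R\sin\alpha)$. The directrix (associated with the focus at the origin) of the ellipse with foci $(0,0)$ and $(F_x,F_y)$ and semi-major axis $a$ is the line $d_K(x,y,\alpha)=0$, where $$d_K(x,y,\alpha)=xF_x+yF_y+2a^2-\tfrac12(F_x^2+F_y^2).$$ The envelope curve of the family is determined by the two equations $d_K(x,y,\alpha)=0$ and $\partial_\alpha d_K(x,y,\alpha)=0$; by an envelope curve is meant a curve which contains the envelope of the family of directrices along a billiard orbit with the first integrals (equivalently $a$ and $R$) fixed.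
   Formalization: Part (i) is stated under the extra assumption R² ≠ 4a² + 4c_K²; when equality holds, the denominators of the displayed equation vanish and the envelope is just the point F'. *)

theory Defs
  imports "HOL-Analysis.Analysis"
begin

type_synonym pt = "real \<times> real"

text \<open>
  Conic sections in the Euclidean plane, by their focal definitions.  A circle counts as the
  ellipse whose two foci coincide; degenerate loci (points, segments, rays, lines) are excluded.
\<close>

definition ellipse_with_foci :: "pt set \<Rightarrow> pt \<Rightarrow> pt \<Rightarrow> bool" where
  "ellipse_with_foci S f g \<longleftrightarrow>
     (\<exists>A. dist f g < 2 * A \<and> S = {p. dist p f + dist p g = 2 * A})"

definition hyperbola_with_foci :: "pt set \<Rightarrow> pt \<Rightarrow> pt \<Rightarrow> bool" where
  "hyperbola_with_foci S f g \<longleftrightarrow>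
     (\<exists>A. 0 < A \<and> 2 * A < dist f g \<and> S = {p. \<bar>dist p f - dist p g\<bar> = 2 * A})"

definition parabola_with_focus :: "pt set \<Rightarrow> pt \<Rightarrow> bool" where
  "parabola_with_focus S f \<longleftrightarrow>
     (\<exists>L. affine L \<and> aff_dim L = 1 \<and> f \<notin> L \<and> S = {p. dist p f = infdist p L})"

text \<open>
  In what follows \<open>a\<close> is the common semi-major axis of the flight ellipses, \<open>c\<close> the linear
  eccentricity of the boundary conic (with foci \<open>(0, 0)\<close> and \<open>(2 * c, 0)\<close>), and \<open>R\<close> the radius of
  the foci circle, which is centred at \<open>(2 * c, 0)\<close>.
\<close>

definition second_focus :: "real \<Rightarrow> real \<Rightarrow> real \<Rightarrow> pt" where
  "second_focus c R \<alpha> = (2 * c + R * cos \<alpha>, R * sin \<alpha>)"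

definition d_K :: "real \<Rightarrow> real \<Rightarrow> real \<Rightarrow> real \<Rightarrow> real \<Rightarrow> real \<Rightarrow> real" where
  "d_K a c R x y \<alpha> =
     (let (Fx, Fy) = second_focus c R \<alpha>
      in x * Fx + y * Fy + 2 * a\<^sup>2 - (Fx\<^sup>2 + Fy\<^sup>2) / 2)"

definition directrix :: "real \<Rightarrow> real \<Rightarrow> real \<Rightarrow> real \<Rightarrow> pt set" where
  "directrix a c R \<alpha> = {(x, y). d_K a c R x y \<alpha> = 0}"

text \<open>The envelope curve: \<open>d_K = 0\<close> together with the vanishing of its \<open>\<alpha>\<close>-derivative.\<close>

definition directrix_envelope :: "real \<Rightarrow> real \<Rightarrow> real \<Rightarrow> pt set" where
  "directrix_envelope a c R =
     {(x, y). \<exists>\<alpha>. d_K a c R x y \<alpha> = 0 \<and> deriv (\<lambda>\<theta>. d_K a c R x y \<theta>) \<alpha> = 0}"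

definition envelope_conic :: "real \<Rightarrow> real \<Rightarrow> real \<Rightarrow> pt set" where
  "envelope_conic a c R =
     {(x, y). 4 * (R\<^sup>2 - 4 * c\<^sup>2)\<^sup>2 * (x + c * ((4 * c\<^sup>2 - R\<^sup>2 - 4 * a\<^sup>2) / (R\<^sup>2 - 4 * c\<^sup>2)))\<^sup>2
                / (R\<^sup>2 * (4 * a\<^sup>2 + 4 * c\<^sup>2 - R\<^sup>2)\<^sup>2)
              + 4 * (R\<^sup>2 - 4 * c\<^sup>2) * y\<^sup>2 / (4 * a\<^sup>2 + 4 * c\<^sup>2 - R\<^sup>2)\<^sup>2 = 1}"

definition envelope_parabola :: "real \<Rightarrow> real \<Rightarrow> pt set" where
  "envelope_parabola a c = {(x, y). x = c / (2 * a\<^sup>2) * y\<^sup>2 - a\<^sup>2 / (2 * c) + 2 * c}"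

text \<open>
  \<open>directrix a c R \<alpha>\<close> is indeed the directrix, for the focus at the origin, of the ellipse with
  foci \<open>(0, 0)\<close> and \<open>second_focus c R \<alpha>\<close> and semi-major axis \<open>a\<close>, whenever this is a non-circular
  ellipse.
\<close>

lemma infdist_hyperplane:
  fixes n q :: "'a::euclidean_space"
  assumes "n \<noteq> 0"
  shows "infdist q {p. n \<bullet> p = k} = \<bar>n \<bullet> q - k\<bar> / norm n"
proof (rule antisym)
  let ?H = "{p. n \<bullet> p = k}"
  let ?p = "q - ((n \<bullet> q - k) / (norm n)\<^sup>2) *\<^sub>R n"
  have p: "?p \<in> ?H"
    using assms by (simp add: inner_diff_right power2_norm_eq_inner)
  have "dist q ?p = \<bar>n \<bullet> q - k\<bar> / norm n"
    using assms by (simp add: dist_norm power2_eq_square)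
  then show "infdist q ?H \<le> \<bar>n \<bullet> q - k\<bar> / norm n"
    using infdist_le[OF p, of q] by simp
  have "\<bar>n \<bullet> q - k\<bar> / norm n \<le> dist q x" if "x \<in> ?H" for x
  proof -
    have "\<bar>n \<bullet> q - k\<bar> = \<bar>n \<bullet> (q - x)\<bar>"
      using that by (simp add: inner_diff_right)
    also have "\<dots> \<le> norm n * norm (q - x)"
      by (rule Cauchy_Schwarz_ineq2)
    finally show ?thesis
      using assms by (simp add: dist_norm field_simps)
  qed
  then show "\<bar>n \<bullet> q - k\<bar> / norm n \<le> infdist q ?H"
    using p by (subst infdist_notempty) (auto intro!: cINF_greatest)
qed

lemma d_K_inner:
  "d_K a c R x y \<alpha> =
     second_focus c R \<alpha> \<bullet> (x, y) - ((norm (second_focus c R \<alpha>))\<^sup>2 / 2 - 2 * a\<^sup>2)"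
  by (simp add: d_K_def second_focus_def inner_prod_def norm_Pair algebra_simps)

lemma directrix_flight_ellipse:
  fixes a c R \<alpha> :: real
  defines "F2 \<equiv> second_focus c R \<alpha>"
  assumes F2: "F2 \<noteq> 0" "norm F2 < 2 * a"
  shows "{p. dist p (0, 0) + dist p F2 = 2 * a} =
         {p. dist p (0, 0) = norm F2 / (2 * a) * infdist p (directrix a c R \<alpha>)}"
proof -
  define k where "k = (norm F2)\<^sup>2 / 2 - 2 * a\<^sup>2"
  have a: "a > 0" using F2 norm_ge_zero[of F2] by linarith
  have z: "(0, 0) = (0 :: pt)" by (simp add: zero_prod_def)
  have L: "directrix a c R \<alpha> = {p. F2 \<bullet> p = k}"
    unfolding directrix_def d_K_inner k_def F2_def by auto
  have k0: "k < 0"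
    using power_strict_mono[OF F2(2), of 2] by (simp add: k_def power_mult_distrib)
  have "dist p 0 + dist p F2 = 2 * a \<longleftrightarrow> 2 * a * norm p = \<bar>F2 \<bullet> p - k\<bar>" for p
  proof -
    let ?t = "2 * a - norm p"
    have pos: "F2 \<bullet> p - k > - (2 * a * norm p)"
    proof -
      have "\<bar>F2 \<bullet> p\<bar> \<le> norm F2 * norm p" by (rule Cauchy_Schwarz_ineq2)
      also have "\<dots> \<le> 2 * a * norm p" using F2(2) by (intro mult_right_mono) auto
      finally show ?thesis using k0 by linarith
    qed
    have sq: "(dist p F2)\<^sup>2 = (norm p)\<^sup>2 - 2 * (F2 \<bullet> p) + (norm F2)\<^sup>2"
      unfolding dist_norm power2_norm_eq_inner
      by (simp add: inner_diff_left inner_diff_right inner_commute)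
    have "?t \<ge> 0" if "2 * a * norm p = F2 \<bullet> p - k"
    proof (rule ccontr)
      assume "\<not> ?t \<ge> 0"
      then have "norm p > 2 * a" by simp
      have "F2 \<bullet> p \<le> norm F2 * norm p" by (rule norm_cauchy_schwarz)
      then have "2 * a * norm p \<le> norm F2 * norm p + (2 * a\<^sup>2 - (norm F2)\<^sup>2 / 2)"
        using that by (simp add: k_def)
      then have "(2 * a - norm F2) * norm p \<le> (2 * a - norm F2) * ((2 * a + norm F2) / 2)"
        by (simp add: algebra_simps power2_eq_square)
      then have "norm p \<le> (2 * a + norm F2) / 2"
        using F2(2) by (simp add: mult_le_cancel_left_pos)
      then show False using \<open>norm p > 2 * a\<close> F2(2) by simp
    qed
    moreover have "(dist p F2)\<^sup>2 = ?t\<^sup>2 \<longleftrightarrow> 2 * a * norm p = F2 \<bullet> p - k"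
      unfolding sq k_def by (simp add: power2_eq_square algebra_simps) argo
    moreover have "dist p F2 = ?t \<longleftrightarrow> ?t \<ge> 0 \<and> (dist p F2)\<^sup>2 = ?t\<^sup>2"
      by (metis power2_eq_iff_nonneg zero_le_dist)
    moreover have "2 * a * norm p = \<bar>F2 \<bullet> p - k\<bar> \<longleftrightarrow> 2 * a * norm p = F2 \<bullet> p - k"
      using pos a by (auto simp: abs_if)
    ultimately show ?thesis by (auto simp: algebra_simps)
  qed
  then show ?thesis
    using F2(1) a unfolding L z infdist_hyperplane[OF F2(1)] by (auto simp: field_simps)
qed

end

theory Submission
  imports Defs
begin

text \<open>
  Put \<open>u = x - 2 c\<close> and \<open>K = 2 a\<^sup>2 + 2 c\<^sup>2 - R\<^sup>2 / 2\<close>. Then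
  \<open>d_K = R (u cos \<alpha> + y sin \<alpha>) + (2 c u + K)\<close>, so \<open>\<partial>\<^sub>\<alpha> d_K = 0\<close> says that \<open>(u, y)\<close> is parallel
  to \<open>(cos \<alpha>, sin \<alpha>)\<close>, and eliminating \<open>\<alpha>\<close> gives \<open>R\<^sup>2 (u\<^sup>2 + y\<^sup>2) = (2 c u + K)\<^sup>2\<close>. This is the
  focus-directrix equation of a conic with focus \<open>(2 c, 0)\<close> and eccentricity \<open>2 c / R\<close>.
\<close>

text \<open>With \<open>r\<close>, \<open>s\<close> the two distances, the difference of the sides
  of the squared equation splits into the four factors \<open>r + s - 2 * A\<close>,
  \<open>r - s - 2 * A\<close>, \<open>r - s + 2 * A\<close> and \<open>r + s + 2 * A\<close>. The
  first gives the sum condition, the next two the difference condition. The last vanishes only when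
  \<open>r = s = A = 0\<close>, where the sum condition holds too.\<close>

lemma dist_sum_or_diff_eq_iff:
  fixes f g p :: "'a::metric_space"
  assumes "A \<ge> 0"
  shows "dist p f + dist p g = 2 * A \<or> \<bar>dist p f - dist p g\<bar> = 2 * A \<longleftrightarrow>
         ((dist p g)\<^sup>2 - (dist p f)\<^sup>2 - 4 * A\<^sup>2)\<^sup>2 = 16 * A\<^sup>2 * (dist p f)\<^sup>2"
proof -
  let ?r = "dist p f" and ?s = "dist p g"
  have "(?s\<^sup>2 - ?r\<^sup>2 - 4 * A\<^sup>2)\<^sup>2 - 16 * A\<^sup>2 * ?r\<^sup>2 =
        (?r + ?s - 2 * A) * (?r - ?s - 2 * A) * (?r - ?s + 2 * A) * (?r + ?s + 2 * A)"
    by algebra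
  then have "(?s\<^sup>2 - ?r\<^sup>2 - 4 * A\<^sup>2)\<^sup>2 = 16 * A\<^sup>2 * ?r\<^sup>2 \<longleftrightarrow>
        ?r + ?s - 2 * A = 0 \<or> ?r - ?s - 2 * A = 0 \<or> ?r - ?s + 2 * A = 0 \<or> ?r + ?s + 2 * A = 0"
    by (metis (no_types, lifting) eq_iff_diff_eq_0 mult_eq_0_iff)
  moreover have "?r \<ge> 0" "?s \<ge> 0" by auto
  ultimately show ?thesis
    using assms by (smt (verit))
qed

text \<open>The squared equation treats both kinds of conic at once. The triangle inequality then
  rules out the difference condition if \<open>dist f g < 2 * A\<close>, and the sum condition if
  \<open>2 * A < dist f g\<close>.\<close>

lemma ellipse_or_hyperbola_with_foci:
  assumes "A > 0" and "2 * A \<noteq> dist f g"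
    and S: "S = {p. ((dist p g)\<^sup>2 - (dist p f)\<^sup>2 - 4 * A\<^sup>2)\<^sup>2 = 16 * A\<^sup>2 * (dist p f)\<^sup>2}"
  shows "ellipse_with_foci S f g \<or> hyperbola_with_foci S f g"
proof -
  have S': "S = {p. dist p f + dist p g = 2 * A \<or> \<bar>dist p f - dist p g\<bar> = 2 * A}"
    unfolding S using assms(1) by (subst dist_sum_or_diff_eq_iff) auto
  have tri: "\<bar>dist p f - dist p g\<bar> \<le> dist f g" "dist f g \<le> dist p f + dist p g" for p
    using dist_triangle[of p f g] dist_triangle[of p g f] dist_triangle[of f g p]
    by (simp_all add: dist_commute)
  consider "dist f g < 2 * A" | "2 * A < dist f g"
    using assms(2) by linarith
  then show ?thesis
  proof cases
    case 1
    then have "S = {p. dist p f + dist p g = 2 * A}"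
      unfolding S' using tri(1) by (smt (verit) Collect_cong)
    with 1 show ?thesis unfolding ellipse_with_foci_def by blast
  next
    case 2
    then have "S = {p. \<bar>dist p f - dist p g\<bar> = 2 * A}"
      unfolding S' using tri(2) by (smt (verit) Collect_cong)
    with 2 assms(1) show ?thesis unfolding hyperbola_with_foci_def by blast
  qed
qed

lemma dist_Pair_square: "(dist (x, y) (u, v))\<^sup>2 = (x - u)\<^sup>2 + (y - v)\<^sup>2" for x y u v :: real
  by (simp add: dist_Pair_Pair dist_real_def)

text \<open>The second equation makes \<open>(u, y)\<close> a multiple of the unit vector
  \<open>(cos \<alpha>, sin \<alpha>)\<close>, and the first fixes the factor as
  \<open>- w / R\<close>. Such an angle exists exactly when \<open>(u, y)\<close> has length
  \<open>\<bar>w / R\<bar>\<close>.\<close>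

lemma ex_angle_iff:
  fixes u y w R :: real
  assumes "R \<noteq> 0"
  shows "(\<exists>\<alpha>. R * (u * cos \<alpha> + y * sin \<alpha>) + w = 0 \<and> y * cos \<alpha> = u * sin \<alpha>) \<longleftrightarrow>
         R\<^sup>2 * (u\<^sup>2 + y\<^sup>2) = w\<^sup>2"
proof
  assume "\<exists>\<alpha>. R * (u * cos \<alpha> + y * sin \<alpha>) + w = 0 \<and> y * cos \<alpha> = u * sin \<alpha>"
  then obtain \<alpha> where "R * (u * cos \<alpha> + y * sin \<alpha>) + w = 0" "y * cos \<alpha> = u * sin \<alpha>"
    by blast
  then show "R\<^sup>2 * (u\<^sup>2 + y\<^sup>2) = w\<^sup>2"
    using sin_cos_squared_add[of \<alpha>] by algebra
next
  assume eq: "R\<^sup>2 * (u\<^sup>2 + y\<^sup>2) = w\<^sup>2"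
  show "\<exists>\<alpha>. R * (u * cos \<alpha> + y * sin \<alpha>) + w = 0 \<and> y * cos \<alpha> = u * sin \<alpha>"
  proof (cases "w = 0")
    case True
    \<comment> \<open>Here \<open>u = y = 0\<close>, so every angle will do.\<close>
    then show ?thesis using eq assms by (auto simp: sum_power2_eq_zero_iff)
  next
    case False
    \<comment> \<open>Solving \<open>(u, y) = - (w / R) * (cos \<alpha>, sin \<alpha>)\<close> for
      the unit vector gives these two coordinates.\<close>
    have "(- (R * u / w))\<^sup>2 + (- (R * y / w))\<^sup>2 = R\<^sup>2 * (u\<^sup>2 + y\<^sup>2) / w\<^sup>2"
      by (simp add: power_divide power_mult_distrib add_divide_distrib distrib_left)
    then have "(- (R * u / w))\<^sup>2 + (- (R * y / w))\<^sup>2 = 1"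
      using eq False by simp
    then obtain \<alpha> where \<alpha>: "- (R * u / w) = cos \<alpha>" "- (R * y / w) = sin \<alpha>"
      using sincos_total_2pi by metis
    have "R * (u * cos \<alpha> + y * sin \<alpha>) + w = w - R\<^sup>2 * (u\<^sup>2 + y\<^sup>2) / w"
      unfolding \<alpha>[symmetric] using False by (simp add: field_simps power2_eq_square)
    also have "\<dots> = 0" unfolding eq by (simp add: power2_eq_square)
    finally show ?thesis
      by (intro exI[of _ \<alpha>]) (simp add: \<alpha>[symmetric])
  qed
qed

lemma directrix_envelope_eq:
  assumes "R \<noteq> 0"
  shows "directrix_envelope a c R =
    {(x, y). R\<^sup>2 * ((x - 2 * c)\<^sup>2 + y\<^sup>2) = (2 * c * (x - 2 * c) + (2 * a\<^sup>2 + 2 * c\<^sup>2 - R\<^sup>2 / 2))\<^sup>2}"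
proof -
  \<comment> \<open>The only quadratic terms in sine and cosine come from the squared norm of the
    second focus, where they add up to the constant \<open>R^2\<close>. Hence \<open>d_K\<close> is
    affine in \<open>(cos \<theta>, sin \<theta>)\<close>.\<close>
  have d: "d_K a c R x y = (\<lambda>\<theta>. R * ((x - 2 * c) * cos \<theta> + y * sin \<theta>)
      + (2 * c * (x - 2 * c) + (2 * a\<^sup>2 + 2 * c\<^sup>2 - R\<^sup>2 / 2)))" for x y
  proof
    fix \<theta>
    show "d_K a c R x y \<theta> = R * ((x - 2 * c) * cos \<theta> + y * sin \<theta>)
      + (2 * c * (x - 2 * c) + (2 * a\<^sup>2 + 2 * c\<^sup>2 - R\<^sup>2 / 2))"
      unfolding d_K_def second_focus_def Let_def prod.case
      using sin_cos_squared_add[of \<theta>] by algebra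
  qed
  have "deriv (d_K a c R x y) \<theta> = R * (y * cos \<theta> - (x - 2 * c) * sin \<theta>)" for x y \<theta>
    unfolding d by (rule DERIV_imp_deriv) (auto intro!: derivative_eq_intros simp: algebra_simps)
  then show ?thesis
    unfolding directrix_envelope_def d using ex_angle_iff[OF assms] assms
    by simp
qed

text \<open>Clearing denominators turns the conic equation into the focus-directrix equation
  multiplied by \<open>4 * D\<close>. The hypotheses make the denominators and this factor
  nonzero.\<close>

lemma envelope_conic_eq_directrix_envelope:
  assumes "R \<noteq> 0" "R\<^sup>2 \<noteq> 4 * c\<^sup>2" "R\<^sup>2 \<noteq> 4 * a\<^sup>2 + 4 * c\<^sup>2"
  shows "envelope_conic a c R = directrix_envelope a c R"
proof -
  define D where "D = R\<^sup>2 - 4 * c\<^sup>2"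
  define M where "M = 4 * a\<^sup>2 + 4 * c\<^sup>2 - R\<^sup>2"
  have nz: "D \<noteq> 0" "M \<noteq> 0" using assms by (auto simp: D_def M_def)
  have "4 * D\<^sup>2 * (x + c * ((4 * c\<^sup>2 - R\<^sup>2 - 4 * a\<^sup>2) / D))\<^sup>2 / (R\<^sup>2 * M\<^sup>2) + 4 * D * y\<^sup>2 / M\<^sup>2 = 1
      \<longleftrightarrow> R\<^sup>2 * ((x - 2 * c)\<^sup>2 + y\<^sup>2) = (2 * c * (x - 2 * c) + (2 * a\<^sup>2 + 2 * c\<^sup>2 - R\<^sup>2 / 2))\<^sup>2"
    (is "?l = 1 \<longleftrightarrow> ?r") for x y
  proof -
    \<comment> \<open>This is \<open>D\<close> times the abscissa measured from the centre of the
      conic.\<close>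
    define t where "t = D * x + c * (4 * c\<^sup>2 - R\<^sup>2 - 4 * a\<^sup>2)"
    have "D\<^sup>2 * (x + c * ((4 * c\<^sup>2 - R\<^sup>2 - 4 * a\<^sup>2) / D))\<^sup>2 = t\<^sup>2"
      unfolding power_mult_distrib[symmetric] t_def using nz by (simp add: distrib_left)
    then have "?l = 4 * t\<^sup>2 / (R\<^sup>2 * M\<^sup>2) + 4 * D * y\<^sup>2 / M\<^sup>2"
      by (simp add: mult.assoc)
    also have "\<dots> = (4 * t\<^sup>2 + 4 * D * R\<^sup>2 * y\<^sup>2) / (R\<^sup>2 * M\<^sup>2)"
      using nz assms(1) by (simp add: add_divide_distrib)
    finally have "?l = 1 \<longleftrightarrow> 4 * t\<^sup>2 + 4 * D * R\<^sup>2 * y\<^sup>2 - R\<^sup>2 * M\<^sup>2 = 0"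
      using nz assms(1) by (auto simp: divide_eq_eq)
    also have "4 * t\<^sup>2 + 4 * D * R\<^sup>2 * y\<^sup>2 - R\<^sup>2 * M\<^sup>2 = 4 * D * (R\<^sup>2 * ((x - 2 * c)\<^sup>2 + y\<^sup>2)
        - (2 * c * (x - 2 * c) + (2 * a\<^sup>2 + 2 * c\<^sup>2 - R\<^sup>2 / 2))\<^sup>2)"
      unfolding t_def D_def M_def by algebra
    also have "\<dots> = 0 \<longleftrightarrow> ?r" using nz by simp
    finally show ?thesis .
  qed
  then show ?thesis
    unfolding envelope_conic_def directrix_envelope_eq[OF assms(1)] D_def M_def by simp
qed

lemma envelope_conic_foci:
  assumes "R > 0" "c \<ge> 0" "2 * c \<noteq> R" "R\<^sup>2 \<noteq> 4 * a\<^sup>2 + 4 * c\<^sup>2"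
  defines "g \<equiv> (- (8 * a\<^sup>2 * c / (4 * c\<^sup>2 - R\<^sup>2)), 0 :: real)"
  shows "ellipse_with_foci (envelope_conic a c R) (2 * c, 0) g
       \<or> hyperbola_with_foci (envelope_conic a c R) (2 * c, 0) g"
proof -
  define D where "D = R\<^sup>2 - 4 * c\<^sup>2"
  define K where "K = 2 * a\<^sup>2 + 2 * c\<^sup>2 - R\<^sup>2 / 2"
  \<comment> \<open>The values of \<open>h\<close>, the signed distance from
    \<open>(2 * c, 0)\<close> to the other focus, and \<open>A\<close>, half the major or transverse
    axis, come from matching coefficients: the squared two-focus equation must be
    \<open>(4 * K / D)^2\<close> times the focus-directrix equation.\<close>
  define h where "h = 4 * c * K / D"
  define A where "A = \<bar>K\<bar> * R / \<bar>D\<bar>"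
  have ne: "R\<^sup>2 \<noteq> 4 * c\<^sup>2"
    using assms(1-3) power2_eq_iff_nonneg[of "2 * c" R] by (simp add: power_mult_distrib)
  have nz: "D \<noteq> 0" "K \<noteq> 0" using assms(4) ne by (auto simp: D_def K_def)
  have g: "g = (2 * c + h, 0)"
  proof -
    have "8 * a\<^sup>2 * c = 2 * c * D + 4 * c * K"
      unfolding D_def K_def by algebra
    then have "8 * a\<^sup>2 * c / D = 2 * c + h"
      using nz by (simp add: h_def field_simps)
    moreover have "- (8 * a\<^sup>2 * c / (4 * c\<^sup>2 - R\<^sup>2)) = 8 * a\<^sup>2 * c / D"
      unfolding D_def minus_divide_right by simp
    ultimately show ?thesis by (simp add: g_def)
  qed
  have A: "A > 0" using nz assms(1) by (simp add: A_def)
  \<comment> \<open>The quotient of the focal distance by \<open>2 * A\<close> is the eccentricity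
    \<open>2 * c / R\<close>, which differs from 1.\<close>
  have "dist (2 * c, 0) g = \<bar>h\<bar>" unfolding g by (simp add: dist_Pair_Pair dist_real_def)
  also have "\<dots> = 2 * (\<bar>K\<bar> * (2 * c) / \<bar>D\<bar>)"
    using assms(2) by (simp add: h_def abs_mult)
  also have "\<dots> \<noteq> 2 * A" unfolding A_def using assms(3) nz by simp
  finally have ne': "2 * A \<noteq> dist (2 * c, 0) g" by simp
  have A2: "A\<^sup>2 = K\<^sup>2 * R\<^sup>2 / D\<^sup>2"
    by (simp add: A_def power_divide power_mult_distrib)
  have h2: "h\<^sup>2 - 4 * A\<^sup>2 = - 4 * K\<^sup>2 / D"
  proof -
    have "h\<^sup>2 - 4 * A\<^sup>2 = - 4 * K\<^sup>2 * D / D\<^sup>2"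
      unfolding A2 h_def D_def by (simp add: power_divide power_mult_distrib algebra_simps diff_divide_distrib)
    then show ?thesis using nz by (simp add: power2_eq_square)
  qed
  have "((dist p g)\<^sup>2 - (dist p (2 * c, 0))\<^sup>2 - 4 * A\<^sup>2)\<^sup>2 = 16 * A\<^sup>2 * (dist p (2 * c, 0))\<^sup>2 \<longleftrightarrow>
      p \<in> directrix_envelope a c R" for p
  proof -
    obtain x y where p: "p = (x, y)" by (cases p)
    have "(dist p g)\<^sup>2 - (dist p (2 * c, 0))\<^sup>2 - 4 * A\<^sup>2 = (h\<^sup>2 - 4 * A\<^sup>2) - 2 * h * (x - 2 * c)"
      unfolding p g dist_Pair_square by algebra
    also have "\<dots> = - (4 * K / D) * (2 * c * (x - 2 * c) + K)"
      unfolding h2 unfolding h_def using nz by (simp add: field_simps power2_eq_square)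
    finally have "((dist p g)\<^sup>2 - (dist p (2 * c, 0))\<^sup>2 - 4 * A\<^sup>2)\<^sup>2
        = (4 * K / D)\<^sup>2 * (2 * c * (x - 2 * c) + K)\<^sup>2"
      by (simp only: power_mult_distrib power2_minus)
    moreover have "16 * A\<^sup>2 * (dist p (2 * c, 0))\<^sup>2
        = (4 * K / D)\<^sup>2 * (R\<^sup>2 * ((x - 2 * c)\<^sup>2 + y\<^sup>2))"
      unfolding A2 p dist_Pair_square by (simp add: power_divide power_mult_distrib)
    ultimately show ?thesis
      using nz assms(1) by (auto simp: p directrix_envelope_eq K_def)
  qed
  then have "envelope_conic a c R = {p. ((dist p g)\<^sup>2 - (dist p (2 * c, 0))\<^sup>2 - 4 * A\<^sup>2)\<^sup>2
      = 16 * A\<^sup>2 * (dist p (2 * c, 0))\<^sup>2}"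
    using envelope_conic_eq_directrix_envelope[of R c a] assms(1,4) ne by auto
  then show ?thesis by (rule ellipse_or_hyperbola_with_foci[OF A ne'])
qed

text \<open>For \<open>R = 2 * c\<close> the terms quadratic in \<open>x\<close> cancel, and what
  remains is linear in \<open>x\<close> with the nonzero coefficient
  \<open>8 * a^2 * c\<close>.\<close>

lemma directrix_envelope_eq_parabola:
  assumes "a \<noteq> 0" "c \<noteq> 0"
  shows "directrix_envelope a c (2 * c) = envelope_parabola a c"
proof -
  have "(2 * c)\<^sup>2 * ((x - 2 * c)\<^sup>2 + y\<^sup>2)
        = (2 * c * (x - 2 * c) + (2 * a\<^sup>2 + 2 * c\<^sup>2 - (2 * c)\<^sup>2 / 2))\<^sup>2
      \<longleftrightarrow> x = c / (2 * a\<^sup>2) * y\<^sup>2 - a\<^sup>2 / (2 * c) + 2 * c" (is "?l = ?r \<longleftrightarrow> x = ?x") for x y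
  proof -
    have "8 * a\<^sup>2 * c * ?x = 4 * c\<^sup>2 * y\<^sup>2 - 4 * a^4 + 16 * a\<^sup>2 * c\<^sup>2"
      using assms by (simp add: field_simps power2_eq_square power4_eq_xxxx)
    moreover have "?r - ?l = 8 * a\<^sup>2 * c * x - (4 * c\<^sup>2 * y\<^sup>2 - 4 * a^4 + 16 * a\<^sup>2 * c\<^sup>2)"
      by algebra
    ultimately have "?r - ?l = 8 * a\<^sup>2 * c * (x - ?x)"
      by (simp only: right_diff_distrib)
    then show ?thesis using assms by (metis (no_types, lifting) eq_iff_diff_eq_0 mult_eq_0_iff
      power_not_zero zero_neq_numeral)
  qed
  then show ?thesis
    using assms by (simp add: directrix_envelope_eq envelope_parabola_def)
qed

text \<open>At eccentricity 1 the focus-directrix equation, divided by \<open>(2 * c)^2\<close>,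
  equates the squared distances to the focus and to the directrix.\<close>

lemma envelope_parabola_focus:
  assumes "a \<noteq> 0" "c \<noteq> 0"
  shows "parabola_with_focus (envelope_parabola a c) (2 * c, 0)"
proof -
  \<comment> \<open>This is the line \<open>2 * c * u + K = 0\<close> with
    \<open>u = x - 2 * c\<close>, where \<open>R = 2 * c\<close> gives
    \<open>K = 2 * a^2\<close>.\<close>
  define L :: "pt set" where "L = {p. (1, 0) \<bullet> p = 2 * c - a\<^sup>2 / c}"
  have n: "(1, 0) \<noteq> (0 :: pt)" by (simp add: zero_prod_def)
  have "affine L" unfolding L_def by (rule affine_hyperplane)
  moreover have "aff_dim L = 1"
    unfolding L_def using n by (subst aff_dim_hyperplane) auto
  moreover have "(2 * c, 0) \<notin> L" using assms by (simp add: L_def)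
  moreover have "p \<in> envelope_parabola a c \<longleftrightarrow> dist p (2 * c, 0) = infdist p L" for p
  proof -
    obtain x y where p: "p = (x, y)" by (cases p)
    have inf: "infdist p L = \<bar>x - 2 * c + a\<^sup>2 / c\<bar>"
      unfolding L_def infdist_hyperplane[OF n] p by (simp add: norm_Pair)
    have "dist p (2 * c, 0) = infdist p L \<longleftrightarrow> (dist p (2 * c, 0))\<^sup>2 = (infdist p L)\<^sup>2"
      by (simp add: power2_eq_iff_nonneg infdist_nonneg)
    also have "\<dots> \<longleftrightarrow> (x - 2 * c)\<^sup>2 + y\<^sup>2 = (x - 2 * c + a\<^sup>2 / c)\<^sup>2"
      unfolding inf unfolding p dist_Pair_square by simp
    also have "\<dots> \<longleftrightarrow> (2 * c)\<^sup>2 * ((x - 2 * c)\<^sup>2 + y\<^sup>2) = (2 * c)\<^sup>2 * (x - 2 * c + a\<^sup>2 / c)\<^sup>2"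
      using assms by simp
    also have "(2 * c)\<^sup>2 * (x - 2 * c + a\<^sup>2 / c)\<^sup>2
        = (2 * c * (x - 2 * c) + (2 * a\<^sup>2 + 2 * c\<^sup>2 - (2 * c)\<^sup>2 / 2))\<^sup>2"
      unfolding power_mult_distrib[symmetric] using assms
      by (simp add: distrib_left power_mult_distrib)
    finally show ?thesis
      using assms
      by (simp add: p directrix_envelope_eq flip: directrix_envelope_eq_parabola)
  qed
  ultimately show ?thesis unfolding parabola_with_focus_def by blast
qed

text \<open>The case \<open>R^2 = 4 * a^2 + 4 * c^2\<close> is set apart because there
  \<open>K = 0\<close>: all directrices pass through \<open>(2 * c, 0)\<close>, the envelope shrinks
  to that point, and the denominators of the conic equation vanish.\<close>

theorem theorem3p7:
  fixes a c R :: real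
  assumes "a > 0" and "c \<ge> 0" and "R > 0"
  shows "(2 * c \<noteq> R \<and> R\<^sup>2 \<noteq> 4 * a\<^sup>2 + 4 * c\<^sup>2 \<longrightarrow>
            directrix_envelope a c R \<subseteq> envelope_conic a c R
            \<and> (ellipse_with_foci (envelope_conic a c R)
                  (2 * c, 0) (- (8 * a\<^sup>2 * c / (4 * c\<^sup>2 - R\<^sup>2)), 0)
               \<or> hyperbola_with_foci (envelope_conic a c R)
                  (2 * c, 0) (- (8 * a\<^sup>2 * c / (4 * c\<^sup>2 - R\<^sup>2)), 0)))
       \<and> (2 * c = R \<longrightarrow>
            directrix_envelope a c R = envelope_parabola a c
            \<and> parabola_with_focus (envelope_parabola a c) (2 * c, 0))"
proof (intro conjI impI)
  assume "2 * c \<noteq> R \<and> R\<^sup>2 \<noteq> 4 * a\<^sup>2 + 4 * c\<^sup>2"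
  then have ne: "2 * c \<noteq> R" "R\<^sup>2 \<noteq> 4 * a\<^sup>2 + 4 * c\<^sup>2" by auto
  then have "R\<^sup>2 \<noteq> 4 * c\<^sup>2"
    using assms power2_eq_iff_nonneg[of "2 * c" R] by (simp add: power_mult_distrib)
  then show "directrix_envelope a c R \<subseteq> envelope_conic a c R"
    using envelope_conic_eq_directrix_envelope[of R c a] ne assms by simp
  show "ellipse_with_foci (envelope_conic a c R)
          (2 * c, 0) (- (8 * a\<^sup>2 * c / (4 * c\<^sup>2 - R\<^sup>2)), 0)
        \<or> hyperbola_with_foci (envelope_conic a c R)
          (2 * c, 0) (- (8 * a\<^sup>2 * c / (4 * c\<^sup>2 - R\<^sup>2)), 0)"
    using envelope_conic_foci ne assms by blast
next
  assume "2 * c = R"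
  then show "directrix_envelope a c R = envelope_parabola a c"
    using directrix_envelope_eq_parabola[of a c] assms by auto
next
  assume "2 * c = R"
  then show "parabola_with_focus (envelope_parabola a c) (2 * c, 0)"
    using envelope_parabola_focus assms by auto
qed

end
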